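(* Let $\{p_k\}_{k\in\mathbb{Z}}$ be a real sequence with $1<p^-\le p^+<\infty$, where $p^-:=\inf_{k}p_k$ and $p^+:=\sup_k p_k$; let $a,b:\mathbb{Z}\to(0,+\infty)$ and let $f_k:\mathbb{R}\to\mathbb{R}$, $k\in\mathbb{Z}$, be continuous, with $F_k(t):=\int_0^t f_k(s)\,ds$. Assume: (A) $b_k\to+\infty$ as $|k|\to\infty$ (so that $\alpha:=\sup_{k\in\mathbb{Z}}b_k^{-1/p_k}<\infty$); (F1) $f_k(0)=0$ for all $k\in\mathbb{Z}$; (F2) $\sum_{k\in\mathbb{Z}}\max_{|t|\le T}|f_k(t)|<\infty$ for every $T>0$; (F4) $\displaystyle\liminf_{t\to+\infty}\frac{\sum_{k\in\mathbb{Z}}\max_{|\xi|\le t}F_k(\xi)}{t^{p^-}}<\frac{1}{p^+\alpha^{p^-}}$. Assume moreover that at least one of the following two conditions holds: (F5) $\displaystyle\max\left\{\limsup_{(k,t)\to(+\infty,+\infty)}\frac{F_k(t)}{(a_{k-1}+a_k+b_k)t^{p^+}},\ \limsup_{(k,t)\to(-\infty,+\infty)}\frac{F_k(t)}{(a_{k-1}+a_k+b_k)t^{p^+}}\right\}>\frac1{p^-}$; (F6) $\displaystyle\sup_{k\in\mathbb{Z}}\left(\limsup_{t\to+\infty}\frac{F_k(t)}{(a_{k-1}+a_k+b_k)t^{p^+}}\right)>\frac1{p^-}$. Then the problem $$-\nabla^-\left(a_k|\nabla^+u_k|^{p_k-2}\nabla^+u_k\right)+b_k|u_k|^{p_k-2}u_k=f_k(u_k)\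 \ (k\in\mathbb{Z}),\qquad u_k\to0\ \text{ as } |k|\to\infty,$$ has a sequence $\{u^n\}_{n\in\mathbb{N}}\subset E$ of positive solutions (i.e. $u^n_k>0$ for all $k\in\mathbb{Z}$) with $\|u^n\|_E\to+\infty$ as $n\to\infty$.
   Context: Notation: for $u:\mathbb{Z}\to\mathbb{R}$, $\nabla^-u_k=u_k-u_{k-1}$ and $\nabla^+u_k=u_{k+1}-u_k$; in particular $\nabla^-$ in the equation acts on the sequence $k\mapsto a_k|\nabla^+u_k|^{p_k-2}\nabla^+u_k$. The expression $|x|^{p-2}x$ is understood as $0$ at $x=0$. $l^{p_k}(\mathbb{Z})=\{u:\mathbb{Z}\to\mathbb{R}:\sum_{k\in\mathbb{Z}}|u_k|^{p_k}<\infty\}$, and $$E=\Big\{u\in l^{p_k}(\mathbb{Z}):\ \sum_{k\in\mathbb{Z}}\big(a_k|\nabla^+u_k|^{p_k}+b_k|u_k|^{p_k}\big)<\infty\Big\},$$ with norm $\|u\|_E=\inf\{\eta>0:\sum_{k\in\mathbb{Z}}(a_k|\nabla^+u_k/\eta|^{p_k}+b_k|u_k/\eta|^{p_k})\le1\}$. The limsup as $(k,t)\to(+\infty,+\infty)$ (resp. $(-\infty,+\infty)$) is the joint upper limit: $\lim_{N\to\infty}$ of the supremum over all integers $k\ge N$ (resp. $k\le -N$) and reals $t\ge N$. *)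

theory Defs
  imports "HOL-Analysis.Analysis"
begin

definition nabla_minus :: "(int \<Rightarrow> real) \<Rightarrow> int \<Rightarrow> real" where
  "nabla_minus u k = u k - u (k - 1)"

definition nabla_plus :: "(int \<Rightarrow> real) \<Rightarrow> int \<Rightarrow> real" where
  "nabla_plus u k = u (k + 1) - u k"

text \<open>\<open>|x|^(q-2) x\<close>; it vanishes at \<open>x = 0\<close> for every \<open>q\<close>.\<close>
definition signed_power :: "real \<Rightarrow> real \<Rightarrow> real" where
  "signed_power q x = \<bar>x\<bar> powr (q - 2) * x"

text \<open>The filter expressing \<open>|k| \<rightarrow> \<infinity>\<close> for integers \<open>k\<close>.\<close>
abbreviation int_infinity :: "int filter" where
  "int_infinity \<equiv> filtercomap abs at_top"

text \<open>The real-valued extrema below are meaningful only for sequences that are bounded on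
  the relevant side.\<close>
definition p_minus :: "(int \<Rightarrow> real) \<Rightarrow> real" where
  "p_minus p = (INF k. p k)"

definition p_plus :: "(int \<Rightarrow> real) \<Rightarrow> real" where
  "p_plus p = (SUP k. p k)"

definition alpha :: "(int \<Rightarrow> real) \<Rightarrow> (int \<Rightarrow> real) \<Rightarrow> real" where
  "alpha b p = (SUP k. b k powr (- 1 / p k))"

text \<open>The integral is oriented: for \<open>t < 0\<close> it is minus the integral over \<open>[t, 0]\<close>.\<close>
definition primitive :: "(int \<Rightarrow> real \<Rightarrow> real) \<Rightarrow> int \<Rightarrow> real \<Rightarrow> real" where
  "primitive f k t = (LBINT s=0..t. f k s)"

definition energy_term ::
  "(int \<Rightarrow> real) \<Rightarrow> (int \<Rightarrow> real) \<Rightarrow> (int \<Rightarrow> real) \<Rightarrow> (int \<Rightarrow> real) \<Rightarrow> int \<Rightarrow> real" where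
  "energy_term a b p u k = a k * \<bar>nabla_plus u k\<bar> powr p k + b k * \<bar>u k\<bar> powr p k"

definition variable_lp :: "(int \<Rightarrow> real) \<Rightarrow> (int \<Rightarrow> real) set" where
  "variable_lp p = {u. (\<lambda>k. \<bar>u k\<bar> powr p k) summable_on UNIV}"

definition space_E ::
  "(int \<Rightarrow> real) \<Rightarrow> (int \<Rightarrow> real) \<Rightarrow> (int \<Rightarrow> real) \<Rightarrow> (int \<Rightarrow> real) set" where
  "space_E a b p = {u \<in> variable_lp p. energy_term a b p u summable_on UNIV}"

text \<open>Summability is required explicitly because \<open>infsum\<close> is 0 on non-summable families.\<close>
definition norm_E ::
  "(int \<Rightarrow> real) \<Rightarrow> (int \<Rightarrow> real) \<Rightarrow> (int \<Rightarrow> real) \<Rightarrow> (int \<Rightarrow> real) \<Rightarrow> real" where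
  "norm_E a b p u = Inf {\<eta>. \<eta> > 0 \<and>
     energy_term a b p (\<lambda>k. u k / \<eta>) summable_on UNIV \<and>
     (\<Sum>\<^sub>\<infinity>k. energy_term a b p (\<lambda>k. u k / \<eta>) k) \<le> 1}"

definition is_solution ::
  "(int \<Rightarrow> real) \<Rightarrow> (int \<Rightarrow> real) \<Rightarrow> (int \<Rightarrow> real) \<Rightarrow> (int \<Rightarrow> real \<Rightarrow> real) \<Rightarrow> (int \<Rightarrow> real) \<Rightarrow> bool" where
  "is_solution a b p f u \<longleftrightarrow>
     (\<forall>k. - nabla_minus (\<lambda>j. a j * signed_power (p j) (nabla_plus u j)) k
          + b k * signed_power (p k) (u k) = f k (u k)) \<and>
     (u \<longlongrightarrow> 0) int_infinity"

definition growth_quotient ::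
  "(int \<Rightarrow> real) \<Rightarrow> (int \<Rightarrow> real) \<Rightarrow> (int \<Rightarrow> real) \<Rightarrow> (int \<Rightarrow> real \<Rightarrow> real) \<Rightarrow> int \<Rightarrow> real \<Rightarrow> real" where
  "growth_quotient a b p f k t =
     primitive f k t / ((a (k - 1) + a k + b k) * t powr p_plus p)"

definition cond_F4 :: "(int \<Rightarrow> real) \<Rightarrow> (int \<Rightarrow> real) \<Rightarrow> (int \<Rightarrow> real \<Rightarrow> real) \<Rightarrow> bool" where
  "cond_F4 b p f \<longleftrightarrow>
     Liminf at_top (\<lambda>t::real.
       ereal ((\<Sum>\<^sub>\<infinity>k. SUP \<xi>\<in>{-t..t}. primitive f k \<xi>) / t powr p_minus p))
     < ereal (1 / (p_plus p * alpha b p powr p_minus p))"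

definition cond_F5 ::
  "(int \<Rightarrow> real) \<Rightarrow> (int \<Rightarrow> real) \<Rightarrow> (int \<Rightarrow> real) \<Rightarrow> (int \<Rightarrow> real \<Rightarrow> real) \<Rightarrow> bool" where
  "cond_F5 a b p f \<longleftrightarrow>
     max (Limsup (at_top \<times>\<^sub>F at_top) (\<lambda>(k, t). ereal (growth_quotient a b p f k t)))
         (Limsup (at_bot \<times>\<^sub>F at_top) (\<lambda>(k, t). ereal (growth_quotient a b p f k t)))
     > ereal (1 / p_minus p)"

definition cond_F6 ::
  "(int \<Rightarrow> real) \<Rightarrow> (int \<Rightarrow> real) \<Rightarrow> (int \<Rightarrow> real) \<Rightarrow> (int \<Rightarrow> real \<Rightarrow> real) \<Rightarrow> bool" where
  "cond_F6 a b p f \<longleftrightarrow>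
     (SUP k. Limsup at_top (\<lambda>t. ereal (growth_quotient a b p f k t))) > ereal (1 / p_minus p)"

end

theory Submission
  imports Defs
begin

text \<open>
  Solutions are minimisers of \<open>J = \<Phi> - \<Psi>\<close>, where \<open>\<Phi> u = \<Sum> (a k |\<nabla>u k|^(p k) + b k |u k|^(p k)) / p k\<close>
  and \<open>\<Psi> u = \<Sum> F k (u k)\<close>, over the nonnegative sequences with \<open>\<Phi> u \<le> r\<close>. This set is compact for
  pointwise convergence. By (F4) there are arbitrarily large \<open>r\<close> with \<open>\<Psi> < r\<close> on the set, so that \<open>J > 0\<close> on
  \<open>\<Phi> = r\<close> while \<open>J 0 = 0\<close>; hence \<open>\<Phi> u < r\<close> for every minimiser \<open>u\<close>. Varying one coordinate at a time
  then gives the equation wherever \<open>u k > 0\<close> and a one-sided inequality wherever \<open>u k = 0\<close>, and the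
  inequality forces \<open>u > 0\<close> everywhere unless \<open>u = 0\<close>. By (F5) or (F6) applied to sequences supported
  at one point, \<open>J\<close> is unbounded below, whereas it is bounded below on norm-bounded sets, so the
  minimisers have arbitrarily large norms.
\<close>

section \<open>Calculus, compactness and summation facts\<close>

text \<open>Away from 0 the modulus is locally plus or minus the identity. At 0 the difference
  quotient has modulus \<open>\<bar>h\<bar> powr (q - 1) / q\<close>, which tends to 0 because
  \<open>q > 1\<close>.\<close>

lemma powr_primitive_has_derivative:
  fixes q x :: real
  assumes "q > 1"
  shows "((\<lambda>y. \<bar>y\<bar> powr q / q) has_real_derivative signed_power q x) (at x)"
proof -
  consider "x > 0" | "x < 0" | "x = 0" by linarith
  then show ?thesis
  proof cases
    case 1
    have "((\<lambda>y. y powr q / q) has_real_derivative signed_power q x) (at x)"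
      using 1 assms by (auto intro!: derivative_eq_intros simp: signed_power_def powr_diff power2_eq_square field_simps)
    then show ?thesis
      by (rule DERIV_cong_ev[THEN iffD1, rotated -1])
         (use 1 in \<open>auto intro!: eventually_mono[OF eventually_nhds_in_open[of "{0<..}"]]\<close>)
  next
    case 2
    have "((\<lambda>y. (- y) powr q / q) has_real_derivative signed_power q x) (at x)"
      using 2 assms by (auto intro!: derivative_eq_intros simp: signed_power_def powr_diff power2_eq_square field_simps)
    then show ?thesis
      by (rule DERIV_cong_ev[THEN iffD1, rotated -1])
         (use 2 in \<open>auto intro!: eventually_mono[OF eventually_nhds_in_open[of "{..<0}"]]\<close>)
  next
    case 3
    have "((\<lambda>h::real. \<bar>h\<bar> powr (q - 1) / q) \<longlongrightarrow> 0) (at 0)"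
      using assms by (auto intro!: tendsto_eq_intros)
    then have "((\<lambda>h::real. norm (\<bar>h\<bar> powr q / q / h)) \<longlongrightarrow> 0) (at 0)"
      by (rule Lim_transform_eventually)
         (use assms in \<open>auto simp: eventually_at_filter powr_diff abs_mult\<close>)
    then show ?thesis
      unfolding 3 DERIV_def by (subst (asm) tendsto_norm_zero_iff) (simp add: signed_power_def)
  qed
qed

text \<open>Tychonoff's theorem: the topology on functions is that of pointwise convergence.\<close>

lemma compact_box:
  "compact {u :: 'i \<Rightarrow> real. \<forall>k. u k \<in> {0..T}}"
proof -
  have "compactin (product_topology (\<lambda>_. euclidean) UNIV) (PiE (UNIV::'i set) (\<lambda>_. {0..T::real}))"
    by (simp add: compactin_PiE)
  moreover have "PiE (UNIV::'i set) (\<lambda>_. {0..T::real}) = {u. \<forall>k. u k \<in> {0..T}}"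
    by (auto simp: PiE_def Pi_def extensional_def)
  ultimately show ?thesis
    by (simp add: euclidean_product_topology)
qed

text \<open>Minimising \<open>s - \<Psi> u\<close> over the epigraph of \<open>\<Sum> e\<close> replaces the lower semicontinuous
  functional \<open>\<Sum> e - \<Psi>\<close> by a continuous one.\<close>
lemma minimizer_on_sublevel:
  fixes e :: "('i \<Rightarrow> real) \<Rightarrow> 'i \<Rightarrow> real"
  assumes e_cont: "\<And>k. continuous_on UNIV (\<lambda>u. e u k)"
    and e_nonneg: "\<And>u k. e u k \<ge> 0"
    and psi_cont: "continuous_on {u. \<forall>k. u k \<in> {0..T}} \<psi>"
    and box: "\<And>u k. (\<And>k. 0 \<le> u k) \<Longrightarrow> (\<And>k. e u k \<le> r) \<Longrightarrow> u k \<le> T"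
    and S_def: "S = {u. (\<forall>k. 0 \<le> u k) \<and> e u summable_on UNIV \<and> infsum (e u) UNIV \<le> r}"
    and "S \<noteq> {}"
  shows "\<exists>u\<in>S. \<forall>w\<in>S. infsum (e u) UNIV - \<psi> u \<le> infsum (e w) UNIV - \<psi> w"
proof -
  define B where "B = {u :: 'i \<Rightarrow> real. \<forall>k. u k \<in> {0..T}}"
  \<comment> \<open>The epigraph, with the bound on the sum of \<open>e u\<close> written as bounds
    on all finite partial sums. Each of these is a closed condition; as \<open>e\<close> is
    nonnegative, together they give summability as well as the bound on the sum.\<close>
  define K where "K = (B \<times> {0..r}) \<inter> (\<Inter>F\<in>{F. finite F}. {x. (\<Sum>k\<in>F. e (fst x) k) \<le> snd x})"
  have e_cont': "continuous_on UNIV (\<lambda>x::('i \<Rightarrow> real) \<times> real. e (fst x) k)" for k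
    by (rule continuous_on_compose2[OF e_cont]) (auto intro: continuous_intros)
  have "compact K"
    unfolding K_def
    by (intro compact_Int_closed compact_Times closed_INT ballI closed_Collect_le continuous_intros e_cont')
       (auto simp: B_def compact_box simp del: atLeastAtMost_iff)
  have sub: "e u k \<le> s" if "\<And>F. finite F \<Longrightarrow> sum (e u) F \<le> s" for u k s
    using that[of "{k}"] by simp
  have in_S: "u \<in> S \<and> infsum (e u) UNIV \<le> s" if "(u, s) \<in> K" for u s
  proof -
    have *: "sum (e u) F \<le> s" if "finite F" for F
      using \<open>(u, s) \<in> K\<close> that by (auto simp: K_def)
    have "e u summable_on UNIV"
      by (rule nonneg_bdd_above_summable_on) (auto simp: e_nonneg intro!: bdd_aboveI[of _ s] *)
    moreover have "infsum (e u) UNIV \<le> s"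
      using calculation by (rule infsum_le_finite_sums) (use * in auto)
    ultimately show ?thesis using that by (auto simp: S_def K_def B_def)
  qed
  have in_K: "(w, infsum (e w) UNIV) \<in> K" if "w \<in> S" for w
  proof -
    have fin: "sum (e w) F \<le> infsum (e w) UNIV" if "finite F" for F
      using \<open>w \<in> S\<close> that by (intro finite_sum_le_infsum) (auto simp: S_def e_nonneg)
    have "w k \<le> T" for k
      by (rule box) (use \<open>w \<in> S\<close> sub[OF fin] in \<open>auto simp: S_def intro: order_trans\<close>)
    then show ?thesis
      using that fin by (auto simp: K_def B_def S_def intro!: infsum_nonneg e_nonneg)
  qed
  have "continuous_on K (\<lambda>x. snd x - \<psi> (fst x))"
    by (intro continuous_intros continuous_on_compose2[OF psi_cont]) (auto simp: K_def B_def)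
  moreover have "K \<noteq> {}" using \<open>S \<noteq> {}\<close> in_K by blast
  ultimately obtain x where x: "x \<in> K" "\<And>y. y \<in> K \<Longrightarrow> snd x - \<psi> (fst x) \<le> snd y - \<psi> (fst y)"
    using continuous_attains_inf[OF \<open>compact K\<close>] by blast
  obtain u s where us: "x = (u, s)" by force
  show ?thesis
  proof (intro bexI ballI)
    show "u \<in> S" using in_S x(1) us by blast
    fix w assume "w \<in> S"
    show "infsum (e u) UNIV - \<psi> u \<le> infsum (e w) UNIV - \<psi> w"
      \<comment> \<open>The minimising pair may lie above the graph, but replacing \<open>s\<close>
        by the sum of \<open>e u\<close> can only lower the value.\<close>
      using x(2)[OF in_K[OF \<open>w \<in> S\<close>]] in_S[of u s] x(1) us by auto
  qed
qed

lemma frequently_of_less_Limsup: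
  fixes g :: "'x \<Rightarrow> 'y :: complete_linorder"
  assumes "c < Limsup F g"
  shows "\<exists>\<^sub>F x in F. c < g x"
proof (rule ccontr)
  assume "\<not> (\<exists>\<^sub>F x in F. c < g x)"
  then have "\<forall>\<^sub>F x in F. g x \<le> c" by (simp add: not_frequently not_less)
  then have "Limsup F g \<le> c" by (rule Limsup_bounded)
  with assms show False by simp
qed

lemma frequently_of_Liminf_less:
  fixes g :: "'x \<Rightarrow> 'y :: complete_linorder"
  assumes "Liminf F g < c"
  shows "\<exists>\<^sub>F x in F. g x < c"
proof (rule ccontr)
  assume "\<not> (\<exists>\<^sub>F x in F. g x < c)"
  then have "\<forall>\<^sub>F x in F. c \<le> g x" by (simp add: not_frequently not_less)
  then have "c \<le> Liminf F g" by (rule Liminf_bounded)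
  with assms show False by simp
qed

text \<open>The difference of the two families has finite support. Needed for changes of one
  coordinate, which affect two energy terms and one term of the potential.\<close>

lemma infsum_finite_change:
  fixes g h :: "'a \<Rightarrow> real"
  assumes "g summable_on UNIV" "finite F" "\<And>j. j \<notin> F \<Longrightarrow> h j = g j"
  shows "h summable_on UNIV" "infsum h UNIV = infsum g UNIV + (\<Sum>j\<in>F. h j - g j)"
proof -
  have "((\<lambda>j. h j - g j) has_sum (\<Sum>j\<in>F. h j - g j)) F"
    using \<open>finite F\<close> by (rule has_sum_finite)
  then have "((\<lambda>j. h j - g j) has_sum (\<Sum>j\<in>F. h j - g j)) UNIV"
    by (rule has_sum_cong_neutral[THEN iffD1, rotated -1]) (auto simp: assms(3))
  from has_sum_add[OF has_sum_infsum[OF assms(1)] this]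
  have "(h has_sum (infsum g UNIV + (\<Sum>j\<in>F. h j - g j))) UNIV" by simp
  then show "h summable_on UNIV" "infsum h UNIV = infsum g UNIV + (\<Sum>j\<in>F. h j - g j)"
    by (auto simp: has_sum_imp_summable infsumI)
qed

section \<open>Standing hypotheses; bounds on exponents and weights\<close>

locale discrete_p_problem =
  fixes p a b :: "int \<Rightarrow> real" and f :: "int \<Rightarrow> real \<Rightarrow> real"
  assumes p_bdd: "bdd_below (range p)" "bdd_above (range p)"
    and p_gt1: "1 < p_minus p"
    and a_pos: "\<And>k. a k > 0"
    and b_pos: "\<And>k. b k > 0"
    and f_cont: "\<And>k. continuous_on UNIV (f k)"
    and b_inf: "filterlim b at_top int_infinity"
    and f_zero: "\<And>k. f k 0 = 0"
    and f_sum: "\<And>T. T > 0 \<Longrightarrow> (\<lambda>k. SUP t\<in>{-T..T}. \<bar>f k t\<bar>) summable_on UNIV"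
begin

lemma p_ge: "p_minus p \<le> p k" and p_le: "p k \<le> p_plus p"
  unfolding p_minus_def p_plus_def using p_bdd by (auto intro: cINF_lower cSUP_upper)

lemma p_k_gt1: "1 < p k"
  using p_gt1 p_ge[of k] by linarith

lemma p_plus_gt1: "1 < p_plus p"
  using p_k_gt1 p_le[of undefined] by (rule less_le_trans)

lemma finite_b_less: "finite {k. b k < c}"
proof -
  have "eventually (\<lambda>k. b k \<ge> c) int_infinity"
    using b_inf by (auto simp: filterlim_at_top)
  then obtain N where N: "\<And>k. \<bar>k\<bar> \<ge> N \<Longrightarrow> b k \<ge> c"
    by (auto simp: eventually_filtercomap eventually_at_top_linorder)
  have "k \<in> {-N..N}" if "b k < c" for k
    using N[of k] that by (cases "\<bar>k\<bar> \<ge> N") auto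
  then have "{k. b k < c} \<subseteq> {-N..N}" by blast
  then show ?thesis by (rule finite_subset) simp
qed

text \<open>Where \<open>b k \<ge> 1\<close> the value is at most 1; by (A) only finitely many
  indices remain, and their values are bounded by their sum. Hence the real supremum
  \<open>alpha\<close> is a genuine one.\<close>

lemma bdd_alpha: "bdd_above (range (\<lambda>k. b k powr (- 1 / p k)))"
proof (rule bdd_aboveI[of _ "1 + (\<Sum>k | b k < 1. b k powr (- 1 / p k))"], clarify)
  fix k
  show "b k powr (- 1 / p k) \<le> 1 + (\<Sum>k | b k < 1. b k powr (- 1 / p k))"
  proof (cases "b k < 1")
    case True
    then have "b k powr (- 1 / p k) \<le> (\<Sum>k | b k < 1. b k powr (- 1 / p k))"
      by (intro member_le_sum finite_b_less) auto
    then show ?thesis by simp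
  next
    case False
    then have "b k powr (- 1 / p k) \<le> b k powr 0"
      using p_k_gt1[of k] by (intro powr_mono) auto
    moreover have "(\<Sum>k | b k < 1. b k powr (- 1 / p k)) \<ge> 0" by (intro sum_nonneg) auto
    ultimately show ?thesis using b_pos[of k] by simp
  qed
qed

lemma alpha_ge: "b k powr (- 1 / p k) \<le> alpha b p"
  unfolding alpha_def by (rule cSUP_upper[OF _ bdd_alpha]) simp

lemma alpha_pos: "alpha b p > 0"
  using alpha_ge[of 0] b_pos[of 0] by (intro less_le_trans[OF _ alpha_ge[of 0]]) simp

lemma b_bounded_below: "\<exists>\<beta>>0. \<forall>k. \<beta> \<le> b k"
proof -
  \<comment> \<open>The inserted 1 is a lower bound at all indices outside the finite set
    \<open>b k < 1\<close>.\<close>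
  let ?A = "insert 1 (b ` {k. b k < 1})"
  have fin: "finite ?A" using finite_b_less by simp
  have "Min ?A > 0" using fin b_pos by (subst Min_gr_iff) auto
  moreover have "Min ?A \<le> b k" for k
    using Min_le[OF fin, of 1] Min_le[OF fin, of "b k"] by (cases "b k < 1") auto
  ultimately show ?thesis by blast
qed

section \<open>Energy and the resulting sup bound\<close>

definition energy :: "(int \<Rightarrow> real) \<Rightarrow> int \<Rightarrow> real" where
  "energy u k = energy_term a b p u k / p k"

text \<open>An energy bound that forces \<open>|u k| \<le> t\<close> for all \<open>k\<close>, as \<open>b k |u k|^(p k) \<le> p_plus * energy\<close>
  gives \<open>|u k| \<le> alpha * (p_plus * energy)^(1 / p k)\<close>.\<close>
definition level :: "real \<Rightarrow> real" where
  "level t = t powr p_minus p / (p_plus p * alpha b p powr p_minus p)"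

lemma energy_term_nonneg: "energy_term a b p u k \<ge> 0"
  using a_pos[of k] b_pos[of k] by (auto simp: energy_term_def)

lemma energy_nonneg: "energy u k \<ge> 0"
  using energy_term_nonneg[of u k] p_k_gt1[of k] by (simp add: energy_def)

lemma b_powr_le: "b k * \<bar>u k\<bar> powr p k \<le> p k * energy u k"
  using a_pos[of k] p_k_gt1[of k] by (simp add: energy_def energy_term_def)

lemma abs_le_of_energy_le:
  assumes "t \<ge> alpha b p" "energy u k \<le> level t"
  shows "\<bar>u k\<bar> \<le> t"
proof -
  have pk: "p k > 1" by (rule p_k_gt1)
  have al: "alpha b p > 0" by (rule alpha_pos)
  have "b k * \<bar>u k\<bar> powr p k \<le> p k * energy u k" by (rule b_powr_le)
  also have "\<dots> \<le> p_plus p * level t"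
    using assms(2) pk p_le[of k] energy_nonneg by (intro mult_mono) (auto intro: order_trans)
  also have "\<dots> = (t / alpha b p) powr p_minus p"
    using p_plus_gt1 al assms(1) by (simp add: level_def powr_divide)
  \<comment> \<open>As \<open>t \<ge> alpha b p\<close>, the base is at least 1, so the exponent may
    be raised from \<open>p_minus p\<close> to \<open>p k\<close>.\<close>
  also have "\<dots> \<le> (t / alpha b p) powr p k"
    using al assms(1) p_ge by (intro powr_mono) auto
  finally have "(b k powr (1 / p k) * \<bar>u k\<bar>) powr p k \<le> (t / alpha b p) powr p k"
    using b_pos[of k] pk by (simp add: powr_mult powr_powr)
  then have "b k powr (1 / p k) * \<bar>u k\<bar> \<le> t / alpha b p"
    using powr_less_mono2[of "p k" "t / alpha b p" "b k powr (1 / p k) * \<bar>u k\<bar>"] pk al assms(1)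
    by (intro leI notI) auto
  then have "b k powr (- 1 / p k) * (b k powr (1 / p k) * \<bar>u k\<bar>) \<le> b k powr (- 1 / p k) * (t / alpha b p)"
    by (rule mult_left_mono) simp
  moreover have "b k powr (- 1 / p k) * b k powr (1 / p k) = 1"
    using b_pos[of k] by (simp flip: powr_add)
  ultimately have "\<bar>u k\<bar> \<le> b k powr (- 1 / p k) * (t / alpha b p)"
    by (simp flip: mult.assoc)
  also have "\<dots> \<le> alpha b p * (t / alpha b p)"
    using alpha_ge al assms(1) by (intro mult_right_mono) auto
  finally show ?thesis using al by simp
qed

section \<open>Primitives of \<open>f\<close> and the potential\<close>

lemma primitive_0: "primitive f k 0 = 0"
  by (simp add: primitive_def flip: zero_ereal_def)

lemma primitive_deriv: "(primitive f k has_real_derivative f k t) (at t)"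
proof -
  \<comment> \<open>Puts \<open>t\<close> in the interior of the interval, so that the derivative
    within it is the full derivative.\<close>
  let ?c = "\<bar>t\<bar> + 1"
  have "((\<lambda>u. LBINT y=ereal 0..ereal u. f k y) has_vector_derivative f k t) (at t within {-?c..?c})"
    by (rule interval_integral_FTC2) (auto intro: continuous_on_subset[OF f_cont])
  moreover have "primitive f k = (\<lambda>u. LBINT y=ereal 0..ereal u. f k y)"
    by (rule ext) (simp only: primitive_def zero_ereal_def)
  moreover have "at t within {-?c..?c} = at t"
    by (rule at_within_interior) auto
  ultimately show ?thesis
    by (simp only: has_real_derivative_iff_has_vector_derivative)
qed

lemma primitive_cont: "continuous_on S (primitive f k)"
  by (meson DERIV_isCont continuous_at_imp_continuous_on primitive_deriv)

lemma abs_f_le: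
  assumes "\<bar>x\<bar> \<le> T"
  shows "\<bar>f k x\<bar> \<le> (SUP t\<in>{-T..T}. \<bar>f k t\<bar>)"
proof (rule cSUP_upper)
  have "compact ((\<lambda>t. \<bar>f k t\<bar>) ` {-T..T})"
    by (intro compact_continuous_image continuous_intros continuous_on_subset[OF f_cont]) auto
  then show "bdd_above ((\<lambda>t. \<bar>f k t\<bar>) ` {-T..T})"
    by (intro bounded_imp_bdd_above compact_imp_bounded)
qed (use assms in auto)

text \<open>Mean value inequality from 0, where the primitive vanishes. It turns (F2) into a
  summable majorant for the primitives.\<close>

lemma abs_primitive_le:
  assumes "\<bar>x\<bar> \<le> T"
  shows "\<bar>primitive f k x\<bar> \<le> T * (SUP t\<in>{-T..T}. \<bar>f k t\<bar>)"
proof -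
  let ?M = "SUP t\<in>{-T..T}. \<bar>f k t\<bar>"
  have "norm (primitive f k x - primitive f k 0) \<le> ?M * norm (x - 0)"
    by (rule field_differentiable_bound[of "{-T..T}" _ "f k"])
       (use assms in \<open>auto intro!: abs_f_le has_field_derivative_at_within[OF primitive_deriv]\<close>)
  also have "\<dots> \<le> ?M * T"
    using assms order_trans[OF abs_ge_zero abs_f_le[OF assms]] by (intro mult_left_mono) auto
  finally show ?thesis by (simp add: primitive_0 mult.commute)
qed

lemma bdd_primitive: "bdd_above (primitive f k ` {-T..T})"
  by (rule bdd_aboveI2[where M = "T * (SUP t\<in>{-T..T}. \<bar>f k t\<bar>)"])
     (use abs_primitive_le[of _ T k] in \<open>auto simp: abs_le_iff\<close>)

lemma primitive_le_SUP: "\<bar>x\<bar> \<le> T \<Longrightarrow> primitive f k x \<le> (SUP \<xi>\<in>{-T..T}. primitive f k \<xi>)"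
  by (rule cSUP_upper[OF _ bdd_primitive]) auto

text \<open>Ensures that the \<open>infsum\<close> in (F4) is a true sum and not the default value
  0. The suprema are nonnegative because 0 lies in the interval.\<close>

lemma SUP_primitive_summable:
  assumes "T > 0"
  shows "(\<lambda>k. SUP \<xi>\<in>{-T..T}. primitive f k \<xi>) summable_on UNIV"
proof (rule summable_on_comparison_test)
  show "(\<lambda>k. T * (SUP t\<in>{-T..T}. \<bar>f k t\<bar>)) summable_on UNIV"
    using f_sum[OF assms] by (rule summable_on_cmult_right)
  show "(SUP \<xi>\<in>{-T..T}. primitive f k \<xi>) \<le> T * (SUP t\<in>{-T..T}. \<bar>f k t\<bar>)" for k
    by (rule cSUP_least) (use assms abs_primitive_le[of _ T k] in \<open>auto simp: abs_le_iff\<close>)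
  show "0 \<le> (SUP \<xi>\<in>{-T..T}. primitive f k \<xi>)" for k
    using primitive_le_SUP[of 0 T k] assms by (simp add: primitive_0)
qed

definition potential :: "(int \<Rightarrow> real) \<Rightarrow> real" where
  "potential u = (\<Sum>\<^sub>\<infinity>k. primitive f k (u k))"

lemma primitive_summable:
  assumes "T > 0" "\<And>k. \<bar>u k\<bar> \<le> T"
  shows "(\<lambda>k. primitive f k (u k)) summable_on UNIV"
proof (rule abs_summable_summable, rule summable_on_comparison_test)
  show "(\<lambda>k. T * (SUP t\<in>{-T..T}. \<bar>f k t\<bar>)) summable_on UNIV"
    using f_sum[OF \<open>T > 0\<close>] by (rule summable_on_cmult_right)
qed (use abs_primitive_le assms in auto)

lemma potential_le:
  assumes "T > 0" "\<And>k. \<bar>u k\<bar> \<le> T"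
  shows "potential u \<le> (\<Sum>\<^sub>\<infinity>k. SUP \<xi>\<in>{-T..T}. primitive f k \<xi>)"
  unfolding potential_def
  by (intro infsum_mono primitive_summable[OF assms] SUP_primitive_summable primitive_le_SUP assms)

text \<open>Weierstrass test: on the box the finite partial sums converge uniformly, and each
  depends on finitely many coordinates, so it is continuous for pointwise convergence.\<close>

lemma potential_cont:
  assumes "T > 0"
  shows "continuous_on {u. \<forall>k. u k \<in> {0..T}} potential"
proof -
  let ?B = "{u :: int \<Rightarrow> real. \<forall>k. u k \<in> {0..T}}"
  have "uniform_limit ?B (\<lambda>X u. \<Sum>k\<in>X. primitive f k (u k))
      (\<lambda>u. \<Sum>\<^sub>\<infinity>k. primitive f k (u k)) (finite_subsets_at_top UNIV)"
  proof (rule Weierstrass_m_test_general)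
    show "(\<lambda>k. T * (SUP t\<in>{-T..T}. \<bar>f k t\<bar>)) summable_on UNIV"
      using f_sum[OF assms] by (rule summable_on_cmult_right)
  qed (auto intro!: abs_primitive_le)
  then show ?thesis
    unfolding potential_def[abs_def]
  proof (rule uniform_limit_theorem[rotated])
    have "continuous_on ?B (\<lambda>u. primitive f k (u k))" for k
      by (rule continuous_on_compose2[OF primitive_cont[of UNIV]])
         (auto intro: continuous_on_subset[OF continuous_on_product_coordinates])
    then show "\<forall>\<^sub>F X in finite_subsets_at_top UNIV. continuous_on ?B (\<lambda>u. \<Sum>k\<in>X. primitive f k (u k))"
      by (intro always_eventually allI continuous_on_sum)
  qed auto
qed

lemma energy_cont: "continuous_on UNIV (\<lambda>u. energy u k)"
proof -
  have "continuous_on UNIV (\<lambda>u::int \<Rightarrow> real. u j)" for j by simp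
  then show ?thesis
    using p_k_gt1[of k]
    unfolding energy_def energy_term_def nabla_plus_def
    by (intro continuous_intros continuous_on_powr') (auto simp: less_imp_le)
qed

section \<open>Constrained minimisation\<close>

definition objective :: "(int \<Rightarrow> real) \<Rightarrow> real" where
  "objective u = infsum (energy u) UNIV - potential u"

text \<open>Without the summability conjunct, every nonnegative sequence of non-summable energy
  would belong to the set when \<open>r \<ge> 0\<close>, since \<open>infsum\<close> is then
  0.\<close>

definition sublevel :: "real \<Rightarrow> (int \<Rightarrow> real) set" where
  "sublevel r = {u. (\<forall>k. 0 \<le> u k) \<and> energy u summable_on UNIV \<and> infsum (energy u) UNIV \<le> r}"

text \<open>The partial derivative of \<open>objective\<close> in the coordinate \<open>k\<close>;
  its vanishing is the equation at \<open>k\<close>.\<close>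

definition residual :: "(int \<Rightarrow> real) \<Rightarrow> int \<Rightarrow> real" where
  "residual u k = - nabla_minus (\<lambda>j. a j * signed_power (p j) (nabla_plus u j)) k
     + b k * signed_power (p k) (u k) - f k (u k)"

lemma energy_le_infsum: "energy u summable_on UNIV \<Longrightarrow> energy u k \<le> infsum (energy u) UNIV"
  using finite_sum_le_infsum[of "energy u" UNIV "{k}"] by (simp add: energy_nonneg)

lemma sublevel_abs_le:
  assumes "t \<ge> alpha b p" "u \<in> sublevel (level t)"
  shows "\<bar>u k\<bar> \<le> t"
  by (rule abs_le_of_energy_le) (use assms energy_le_infsum[of u k] in \<open>auto simp: sublevel_def\<close>)

lemma level_nonneg: "level t \<ge> 0"
  using p_plus_gt1 by (simp add: level_def)

lemma objective_minimizer:
  assumes "t \<ge> alpha b p"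
  shows "\<exists>u\<in>sublevel (level t). \<forall>w\<in>sublevel (level t). objective u \<le> objective w"
  unfolding objective_def
proof (rule minimizer_on_sublevel[OF energy_cont energy_nonneg _ _ sublevel_def])
  show "continuous_on {u. \<forall>k. u k \<in> {0..t}} potential"
    using alpha_pos assms by (intro potential_cont) auto
  show "u k \<le> t" if "\<And>k. energy u k \<le> level t" for u k
    using abs_le_of_energy_le[OF assms that[of k]] by simp
  have "energy (\<lambda>_. 0) = (\<lambda>_. 0)"
    by (simp add: energy_def energy_term_def nabla_plus_def fun_eq_iff)
  then have "(\<lambda>_. 0) \<in> sublevel (level t)"
    by (simp add: sublevel_def level_nonneg)
  then show "sublevel (level t) \<noteq> {}" by blast
qed

section \<open>One-coordinate variations and positivity\<close>

text \<open>Coordinate \<open>k\<close> enters the energy only at index \<open>k - 1\<close>,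
  through the difference, and at index \<open>k\<close>.\<close>

lemma local_energy_deriv:
  "((\<lambda>y. energy (u(k := y)) (k - 1) + energy (u(k := y)) k - primitive f k y)
     has_real_derivative residual u k) (at (u k))"
proof -
  have D: "((\<lambda>y. c * (\<bar>g y\<bar> powr p j / p j)) has_real_derivative c * (signed_power (p j) (g z) * g')) (at z)"
    if "(g has_real_derivative g') (at z)" for c g g' j z
    by (intro DERIV_cmult DERIV_chain2[OF powr_primitive_has_derivative that] p_k_gt1)
  \<comment> \<open>Isolates the dependence on \<open>y\<close>: the last two energy expressions
    leave only the \<open>b\<close>-part at \<open>k - 1\<close>, which is constant in
    \<open>y\<close>.\<close>
  have eq: "energy (u(k := y)) (k - 1) + energy (u(k := y)) k - primitive f k y =
     a (k - 1) * (\<bar>y - u (k - 1)\<bar> powr p (k - 1) / p (k - 1))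
     + a k * (\<bar>u (k + 1) - y\<bar> powr p k / p k) + b k * (\<bar>y\<bar> powr p k / p k)
     + energy u (k - 1) - a (k - 1) * (\<bar>u k - u (k - 1)\<bar> powr p (k - 1) / p (k - 1))
     - primitive f k y" for y
    by (simp add: energy_def energy_term_def nabla_plus_def add_divide_distrib)
  show ?thesis
    unfolding eq
    by (rule derivative_eq_intros D primitive_deriv refl)+
       (simp add: residual_def nabla_minus_def nabla_plus_def)
qed

lemma update_summable:
  assumes "energy u summable_on UNIV"
  shows "energy (u(k := y)) summable_on UNIV"
    and "infsum (energy (u(k := y))) UNIV = infsum (energy u) UNIV
      + (energy (u(k := y)) (k - 1) + energy (u(k := y)) k) - (energy u (k - 1) + energy u k)"
  using infsum_finite_change[OF assms, of "{k - 1, k}" "energy (u(k := y))"]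
  by (auto simp: energy_def energy_term_def nabla_plus_def)

lemma objective_update:
  assumes "energy u summable_on UNIV" "T > 0" "\<And>k. \<bar>u k\<bar> \<le> T"
  shows "objective (u(k := y)) = objective u
    + (energy (u(k := y)) (k - 1) + energy (u(k := y)) k - primitive f k y)
    - (energy u (k - 1) + energy u k - primitive f k (u k))"
  using infsum_finite_change(2)[OF primitive_summable[OF assms(2,3)], of "{k}" "\<lambda>j. primitive f j ((u(k := y)) j)"]
  by (simp add: objective_def potential_def update_summable[OF assms(1)])

text \<open>Nonnegativity always allows a coordinate to be increased, which gives the inequality; it
  can also be decreased when it is positive, which gives equality.\<close>

lemma interior_minimizer_residual:
  assumes u: "u \<in> sublevel r" "infsum (energy u) UNIV < r"
    and min: "\<And>w. w \<in> sublevel r \<Longrightarrow> objective u \<le> objective w"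
    and T: "T > 0" "\<And>k. \<bar>u k\<bar> \<le> T"
  shows "residual u k \<ge> 0" "u k > 0 \<Longrightarrow> residual u k = 0"
proof -
  define h where "h = (\<lambda>y. energy (u(k := y)) (k - 1) + energy (u(k := y)) k - primitive f k y)"
  have h_deriv: "(h has_real_derivative residual u k) (at (u k))"
    unfolding h_def by (rule local_energy_deriv)
  have sm: "energy u summable_on UNIV" and u_nonneg: "u j \<ge> 0" for j
    using u(1) by (auto simp: sublevel_def)
  have upd: "infsum (energy (u(k := y))) UNIV
      = infsum (energy u) UNIV + (h y + primitive f k y) - (h (u k) + primitive f k (u k))" for y
    using update_summable(2)[OF sm, of k y] by (simp add: h_def)
  \<comment> \<open>The strict bound on the energy survives small changes of the coordinate, so
    these stay in the sublevel set.\<close>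
  have "isCont (\<lambda>y. infsum (energy (u(k := y))) UNIV) (u k)"
    unfolding upd by (intro continuous_intros DERIV_isCont[OF h_deriv] DERIV_isCont[OF primitive_deriv])
  moreover have "infsum (energy (u(k := u k))) UNIV < r" using u(2) by simp
  ultimately have "\<forall>\<^sub>F y in at (u k). infsum (energy (u(k := y))) UNIV < r"
    unfolding isCont_def by (rule order_tendstoD(2))
  then obtain d where d: "d > 0" "\<And>y. y \<noteq> u k \<Longrightarrow> dist y (u k) < d \<Longrightarrow> infsum (energy (u(k := y))) UNIV < r"
    unfolding eventually_at by auto
  have h_min: "h (u k) \<le> h y" if "y \<ge> 0" "y \<noteq> u k" "dist y (u k) < d" for y
  proof -
    have "u(k := y) \<in> sublevel r"
      using d(2)[OF that(2,3)] that(1) u_nonneg update_summable(1)[OF sm]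
      by (auto simp: sublevel_def)
    from min[OF this] show ?thesis
      using objective_update[OF sm T, of k y] by (simp add: h_def)
  qed
  show ge: "residual u k \<ge> 0"
  proof (rule ccontr)
    assume "\<not> residual u k \<ge> 0"
    then obtain d' where d': "d' > 0" "\<And>s. s > 0 \<Longrightarrow> s < d' \<Longrightarrow> h (u k + s) < h (u k)"
      using DERIV_neg_dec_right[OF h_deriv] by (auto simp: not_le)
    define s where "s = min d d' / 2"
    have "s > 0" "s < d" "s < d'" using d(1) d'(1) by (auto simp: s_def)
    then show False
      using d'(2)[of s] h_min[of "u k + s"] u_nonneg[of k] by (auto simp: dist_real_def)
  qed
  show "residual u k = 0" if "u k > 0"
  proof (rule ccontr)
    assume "residual u k \<noteq> 0"
    with ge obtain d' where d': "d' > 0" "\<And>s. s > 0 \<Longrightarrow> s < d' \<Longrightarrow> h (u k - s) < h (u k)"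
      using DERIV_pos_inc_left[OF h_deriv] by auto
    \<comment> \<open>Including \<open>u k\<close> keeps \<open>u k - s\<close> nonnegative.\<close>
    define s where "s = min (u k) (min d d') / 2"
    have "s > 0" "s < d" "s < d'" "s < u k" using d(1) d'(1) that by (auto simp: s_def)
    then show False
      using d'(2)[of s] h_min[of "u k - s"] by (auto simp: dist_real_def)
  qed
qed

text \<open>At a zero of a nonnegative \<open>u\<close> the residual is minus a sum of nonnegative multiples of
  powers of the two neighbouring values, so zeros spread to all of \<open>\<int>\<close>.\<close>
lemma positive_of_residual_nonneg:
  assumes u_nonneg: "\<And>k. u k \<ge> 0" and res: "\<And>k. residual u k \<ge> 0" and "u j \<noteq> 0"
  shows "u k > 0"
proof (rule ccontr)
  assume "\<not> u k > 0"
  with u_nonneg[of k] have "u k = 0" by auto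
  have step: "u (i + 1) = 0 \<and> u (i - 1) = 0" if "u i = 0" for i
  proof -
    \<comment> \<open>The terms with \<open>b\<close> and \<open>f\<close> vanish since
      \<open>u i = 0\<close>, the latter by (F1).\<close>
    have "residual u i = - (a i * signed_power (p i) (u (i + 1))
        + a (i - 1) * signed_power (p (i - 1)) (u (i - 1)))"
      using that by (simp add: residual_def nabla_minus_def nabla_plus_def signed_power_def f_zero)
    with res[of i] have "a i * signed_power (p i) (u (i + 1))
        + a (i - 1) * signed_power (p (i - 1)) (u (i - 1)) \<le> 0" by simp
    moreover have "a i * signed_power (p i) (u (i + 1)) \<ge> 0"
      "a (i - 1) * signed_power (p (i - 1)) (u (i - 1)) \<ge> 0"
      using a_pos[of i] a_pos[of "i - 1"] u_nonneg by (auto simp: signed_power_def)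
    ultimately have "a i * signed_power (p i) (u (i + 1)) = 0"
      "a (i - 1) * signed_power (p (i - 1)) (u (i - 1)) = 0" by linarith+
    then show ?thesis
      using a_pos[of i] a_pos[of "i - 1"] by (auto simp: signed_power_def)
  qed
  have "u i = 0" for i
    by (induction i rule: int_induct[where k = k]) (use \<open>u k = 0\<close> step in auto)
  with \<open>u j \<noteq> 0\<close> show False by simp
qed

section \<open>Decay at infinity, membership in E, and the norm\<close>

text \<open>The products \<open>b k * \<bar>u k\<bar> powr p k\<close> stay bounded while
  \<open>b k\<close> tends to infinity.\<close>

lemma tendsto_0_of_energy_le:
  assumes le: "\<And>k. energy u k \<le> r" and "r > 0"
  shows "(u \<longlongrightarrow> 0) int_infinity"
proof (rule tendstoI)
  fix e :: real assume "e > 0"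
  \<comment> \<open>With \<open>m \<le> 1\<close>, \<open>m powr p_plus p\<close> is a lower bound
    for all \<open>m powr p k\<close>, so one threshold for \<open>b k\<close> serves every
    \<open>k\<close>.\<close>
  define m where "m = min 1 e"
  have m: "0 < m" "m \<le> 1" "m \<le> e" using \<open>e > 0\<close> by (auto simp: m_def)
  have "\<forall>\<^sub>F k in int_infinity. b k > p_plus p * r / m powr p_plus p"
    using b_inf by (auto simp: filterlim_at_top_dense)
  then show "\<forall>\<^sub>F k in int_infinity. dist (u k) 0 < e"
  proof eventually_elim
    case (elim k)
    show ?case
    proof (rule ccontr)
      assume "\<not> dist (u k) 0 < e"
      then have "m \<le> \<bar>u k\<bar>" using m by simp
      then have "m powr p k \<le> \<bar>u k\<bar> powr p k"
        using m p_k_gt1[of k] by (intro powr_mono2) auto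
      moreover have "m powr p_plus p \<le> m powr p k"
        using m p_le[of k] by (intro powr_mono') auto
      ultimately have "b k * m powr p_plus p \<le> b k * \<bar>u k\<bar> powr p k"
        using b_pos[of k] by simp
      also have "\<dots> \<le> p k * energy u k" by (rule b_powr_le)
      also have "\<dots> \<le> p_plus p * r"
        using le[of k] p_le[of k] p_k_gt1[of k] energy_nonneg by (intro mult_mono) (auto intro: order_trans)
      finally show False
        using elim m by (simp add: divide_less_eq)
    qed
  qed
qed

lemma energy_term_summable:
  assumes "energy u summable_on UNIV"
  shows "energy_term a b p u summable_on UNIV"
    and "infsum (energy_term a b p u) UNIV \<le> p_plus p * infsum (energy u) UNIV"
proof -
  have le: "energy_term a b p u k \<le> p_plus p * energy u k" for k
    using mult_right_mono[OF p_le[of k] energy_nonneg[of u k]] p_k_gt1[of k] by (simp add: energy_def)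
  show sm: "energy_term a b p u summable_on UNIV"
    by (rule summable_on_comparison_test[OF summable_on_cmult_right[OF assms] le energy_term_nonneg])
  have "infsum (energy_term a b p u) UNIV \<le> (\<Sum>\<^sub>\<infinity>k. p_plus p * energy u k)"
    by (intro infsum_mono sm summable_on_cmult_right assms le)
  then show "infsum (energy_term a b p u) UNIV \<le> p_plus p * infsum (energy u) UNIV"
    by (simp add: infsum_cmult_right' assms)
qed

text \<open>The uniform positive lower bound of \<open>b\<close> lets the energy dominate the
  variable-exponent sum.\<close>

lemma in_space_E:
  assumes "energy u summable_on UNIV"
  shows "u \<in> space_E a b p"
proof -
  obtain \<beta> where \<beta>: "\<beta> > 0" "\<And>k. \<beta> \<le> b k" using b_bounded_below by blast
  have sm: "energy_term a b p u summable_on UNIV" by (rule energy_term_summable[OF assms])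
  have "(\<lambda>k. \<bar>u k\<bar> powr p k) summable_on UNIV"
  proof (rule summable_on_comparison_test)
    show "(\<lambda>k. inverse \<beta> * energy_term a b p u k) summable_on UNIV"
      using sm by (rule summable_on_cmult_right)
    show "\<bar>u k\<bar> powr p k \<le> inverse \<beta> * energy_term a b p u k" for k
    proof -
      have "\<beta> * \<bar>u k\<bar> powr p k \<le> b k * \<bar>u k\<bar> powr p k" by (intro mult_right_mono \<beta>) auto
      also have "\<dots> \<le> energy_term a b p u k" using a_pos[of k] by (simp add: energy_term_def)
      finally show ?thesis using \<beta>(1) by (simp add: field_simps)
    qed
  qed auto
  with sm show ?thesis by (auto simp: space_E_def variable_lp_def)
qed

text \<open>The infimum defining the norm is not over the empty set: \<open>\<eta> = 1 + \<Sum> energy_term\<close> is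
  admissible because \<open>\<eta> powr p k \<ge> \<eta>\<close>.\<close>
lemma energy_le_of_norm_less:
  assumes "energy u summable_on UNIV" "norm_E a b p u < R" "R \<ge> 1"
  shows "energy u k \<le> R powr p_plus p"
proof -
  let ?U = "{\<eta>. \<eta> > 0 \<and> energy_term a b p (\<lambda>k. u k / \<eta>) summable_on UNIV \<and>
     (\<Sum>\<^sub>\<infinity>k. energy_term a b p (\<lambda>k. u k / \<eta>) k) \<le> 1}"
  have sm: "energy_term a b p u summable_on UNIV" by (rule energy_term_summable[OF assms(1)])
  have scale: "energy_term a b p (\<lambda>k. u k / \<eta>) k = energy_term a b p u k / \<eta> powr p k" if "\<eta> > 0" for k \<eta>
    using that by (simp add: energy_term_def nabla_plus_def diff_divide_distrib[symmetric]
        powr_divide add_divide_distrib)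
  have "?U \<noteq> {}"
  proof -
    define \<eta> where "\<eta> = 1 + infsum (energy_term a b p u) UNIV"
    have \<eta>: "\<eta> \<ge> 1" "infsum (energy_term a b p u) UNIV \<le> \<eta>"
      using infsum_nonneg[of UNIV "energy_term a b p u"] energy_term_nonneg by (auto simp: \<eta>_def)
    have le: "energy_term a b p (\<lambda>k. u k / \<eta>) k \<le> energy_term a b p u k * inverse \<eta>" for k
    proof -
      have "\<eta> powr 1 \<le> \<eta> powr p k" using \<eta> p_k_gt1[of k] by (intro powr_mono) auto
      then have "energy_term a b p u k / \<eta> powr p k \<le> energy_term a b p u k / \<eta>"
        using \<eta> energy_term_nonneg by (intro divide_left_mono) auto
      then show ?thesis using \<eta> scale by (simp add: divide_inverse)
    qed
    have sm': "energy_term a b p (\<lambda>k. u k / \<eta>) summable_on UNIV"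
      by (rule summable_on_comparison_test[OF summable_on_cmult_left[OF sm] le energy_term_nonneg])
    have "(\<Sum>\<^sub>\<infinity>k. energy_term a b p (\<lambda>k. u k / \<eta>) k) \<le> (\<Sum>\<^sub>\<infinity>k. energy_term a b p u k * inverse \<eta>)"
      by (intro infsum_mono sm' summable_on_cmult_left sm le)
    also have "\<dots> = infsum (energy_term a b p u) UNIV * inverse \<eta>"
      by (rule infsum_cmult_left')
    also have "\<dots> \<le> \<eta> * inverse \<eta>"
      using \<eta> by (intro mult_right_mono) auto
    also have "\<dots> = 1"
      using \<eta> by simp
    finally have "(\<Sum>\<^sub>\<infinity>k. energy_term a b p (\<lambda>k. u k / \<eta>) k) \<le> 1" .
    moreover have "\<eta> > 0" using \<eta> by linarith
    ultimately show ?thesis using sm' by blast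
  qed
  moreover have "Inf ?U < R" using assms(2) by (simp only: norm_E_def)
  \<comment> \<open>An admissible scale below \<open>R\<close> suffices; the infimum need not be
    attained.\<close>
  ultimately obtain \<eta> where "\<eta> \<in> ?U" "\<eta> < R"
    using cInf_lessD[of ?U R] by blast
  then have \<eta>: "\<eta> > 0" "\<eta> < R" "energy_term a b p (\<lambda>k. u k / \<eta>) summable_on UNIV"
    "infsum (energy_term a b p (\<lambda>k. u k / \<eta>)) UNIV \<le> 1" by blast+
  have "sum (energy_term a b p (\<lambda>k. u k / \<eta>)) {k} \<le> infsum (energy_term a b p (\<lambda>k. u k / \<eta>)) UNIV"
    by (rule finite_sum_le_infsum[OF \<eta>(3)]) (simp_all add: energy_term_nonneg)
  with \<eta>(4) have "energy_term a b p (\<lambda>k. u k / \<eta>) k \<le> 1" by simp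
  then have "energy_term a b p u k \<le> \<eta> powr p k"
    unfolding scale[OF \<eta>(1)] using \<eta>(1) by (simp add: divide_le_eq)
  also have "\<dots> \<le> R powr p k"
    using \<eta>(1,2) p_k_gt1[of k] by (intro powr_mono2) auto
  \<comment> \<open>\<open>R \<ge> 1\<close> makes the bound uniform in \<open>k\<close>.\<close>
  also have "\<dots> \<le> R powr p_plus p"
    using assms(3) p_le by (intro powr_mono) auto
  finally have "energy_term a b p u k \<le> R powr p_plus p" .
  moreover have "energy u k \<le> energy_term a b p u k / 1"
    unfolding energy_def
    by (rule divide_left_mono) (use energy_term_nonneg[of u k] p_k_gt1[of k] in auto)
  ultimately show ?thesis by simp
qed

lemma energy_sum_nonneg: "infsum (energy u) UNIV \<ge> 0"
  by (rule infsum_nonneg) (rule energy_nonneg)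

section \<open>Consequences of the growth conditions\<close>

lemma level_at_top: "filterlim level at_top at_top"
proof -
  have lim: "filterlim (\<lambda>t::real. t powr p_minus p) at_top at_top"
  proof (rule filterlim_at_top_mono[OF filterlim_ident])
    show "\<forall>\<^sub>F t in at_top. t \<le> t powr p_minus p"
      using eventually_ge_at_top[of 1]
    proof eventually_elim
      case (elim t)
      have "t powr 1 \<le> t powr p_minus p"
        by (rule powr_mono) (use elim p_gt1 in auto)
      then show ?case using elim by simp
    qed
  qed
  have pos: "inverse (p_plus p * alpha b p powr p_minus p) > 0"
    using p_plus_gt1 alpha_pos by simp
  have eq: "level t = inverse (p_plus p * alpha b p powr p_minus p) * t powr p_minus p" for t
    by (simp only: level_def divide_inverse mult.commute)
  show ?thesis
    unfolding eq by (rule filterlim_tendsto_pos_mult_at_top[OF tendsto_const pos lim])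
qed

text \<open>A spike at \<open>k\<close> meets two differences and one point, hence the weight
  \<open>a (k - 1) + a k + b k\<close>. Since \<open>t \<ge> 1\<close>, its energy is at most this
  weight times \<open>t powr p_plus p / p_minus p\<close>, while the potential is at least
  \<open>c\<close> times the weight times \<open>t powr p_plus p\<close>.\<close>

lemma spike_objective:
  assumes "t \<ge> 1" and q: "growth_quotient a b p f k t > c" and "c > 1 / p_minus p"
  defines "w \<equiv> (\<lambda>j. if j = k then t else 0)"
  shows "energy w summable_on UNIV"
    and "objective w \<le> - (c - 1 / p_minus p) * (b k * t)"
proof -
  let ?A = "a (k - 1) + a k + b k"
  have A: "?A > 0" using a_pos[of k] a_pos[of "k - 1"] b_pos[of k] by linarith
  have t_le: "t powr p j \<le> t powr p_plus p" for j
    using assms(1) p_le by (intro powr_mono) auto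
  have zero: "energy (\<lambda>_. 0) = (\<lambda>_. 0)"
    by (simp add: energy_def energy_term_def nabla_plus_def fun_eq_iff)
  have w: "w = (\<lambda>_. 0)(k := t)" by (auto simp: w_def)
  have sm0: "energy (\<lambda>_. 0) summable_on UNIV" by (simp add: zero)
  show "energy w summable_on UNIV"
    unfolding w by (rule update_summable(1)[OF sm0])
  have obj0: "objective (\<lambda>_. 0) = 0"
    by (simp add: objective_def potential_def zero primitive_0)
  have piece: "x * t powr p j / p j \<le> x * t powr p_plus p / p_minus p" if "x > 0" for x j
    using that p_gt1 p_ge[of j] t_le[of j] by (intro frac_le mult_left_mono) auto
  have "objective w = energy w (k - 1) + energy w k - primitive f k t"
    using objective_update[OF sm0 zero_less_one, of k t] by (simp add: w obj0 zero primitive_0)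
  also have "energy w (k - 1) + energy w k
      = a (k - 1) * t powr p (k - 1) / p (k - 1) + a k * t powr p k / p k + b k * t powr p k / p k"
    using assms(1) by (simp add: w_def energy_def energy_term_def nabla_plus_def add_divide_distrib)
  also have "\<dots> \<le> a (k - 1) * t powr p_plus p / p_minus p + a k * t powr p_plus p / p_minus p
      + b k * t powr p_plus p / p_minus p"
    by (intro add_mono piece a_pos b_pos)
  finally have "objective w \<le> 1 / p_minus p * (?A * t powr p_plus p) - primitive f k t"
    by (simp add: distrib_right add_divide_distrib)
  moreover have "c * (?A * t powr p_plus p) \<le> primitive f k t"
    using q A assms(1) by (simp add: growth_quotient_def less_divide_eq)
  moreover have "x \<le> - (c - d) * y" if "x \<le> d * y - z" "c * y \<le> z" for x y z d
    using that by (simp add: algebra_simps)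
  ultimately have "objective w \<le> - (c - 1 / p_minus p) * (?A * t powr p_plus p)"
    by blast
  also have "\<dots> \<le> - (c - 1 / p_minus p) * (b k * t)"
  proof -
    have "t powr 1 \<le> t powr p_plus p" using assms(1) p_plus_gt1 by (intro powr_mono) auto
    then have "b k * t \<le> ?A * t powr p_plus p"
      using a_pos[of k] a_pos[of "k - 1"] b_pos[of k] assms(1) by (intro mult_mono) auto
    then show ?thesis using assms(3) by (simp add: mult_left_mono)
  qed
  finally show "objective w \<le> - (c - 1 / p_minus p) * (b k * t)" .
qed

text \<open>The common form in which (F5) and (F6) are used: the constant \<open>c\<close> is fixed
  before \<open>M\<close>, while the index may vary with \<open>M\<close>.\<close>

lemma growth_quotient_large:
  assumes "cond_F5 a b p f \<or> cond_F6 a b p f"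
  shows "\<exists>c>1 / p_minus p. \<forall>M. \<exists>k. \<exists>t\<ge>M. growth_quotient a b p f k t > c"
proof -
  let ?L = "ereal (1 / p_minus p)"
  have pair: ?thesis if L: "?L < Limsup (G \<times>\<^sub>F at_top) (\<lambda>(k, t). ereal (growth_quotient a b p f k t))" for G
  proof -
    \<comment> \<open>A real number strictly between keeps a margin over
      \<open>1 / p_minus p\<close> and is still exceeded frequently.\<close>
    obtain c where c: "?L < ereal c"
      "ereal c < Limsup (G \<times>\<^sub>F at_top) (\<lambda>(k, t). ereal (growth_quotient a b p f k t))"
      using ereal_dense2[OF L] by blast
    have fr: "\<exists>\<^sub>F x in G \<times>\<^sub>F at_top. growth_quotient a b p f (fst x) (snd x) > c"
      using frequently_of_less_Limsup[OF c(2)] by (simp add: case_prod_beta)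
    have "\<exists>k. \<exists>t\<ge>M. growth_quotient a b p f k t > c" for M
    proof -
      have "\<forall>\<^sub>F x in G \<times>\<^sub>F at_top. snd x \<ge> M"
        by (rule eventually_compose_filterlim[OF eventually_ge_at_top filterlim_snd])
      from frequently_ex[OF frequently_eventually_frequently[OF fr this]] show ?thesis by blast
    qed
    with c(1) show ?thesis by (intro exI[of _ c]) simp
  qed
  have single: ?thesis if L: "?L < Limsup at_top (\<lambda>t. ereal (growth_quotient a b p f k t))" for k
  proof -
    obtain c where c: "?L < ereal c"
      "ereal c < Limsup at_top (\<lambda>t. ereal (growth_quotient a b p f k t))"
      using ereal_dense2[OF L] by blast
    have fr: "\<exists>\<^sub>F t in at_top. growth_quotient a b p f k t > c"
      using frequently_of_less_Limsup[OF c(2)] by simp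
    have "\<exists>k. \<exists>t\<ge>M. growth_quotient a b p f k t > c" for M
      using frequently_ex[OF frequently_eventually_frequently[OF fr eventually_ge_at_top[of M]]] by blast
    with c(1) show ?thesis by (intro exI[of _ c]) simp
  qed
  from assms show ?thesis
  proof
    assume "cond_F5 a b p f"
    then show ?thesis
      unfolding cond_F5_def less_max_iff_disj by (elim disjE) (rule pair; assumption)+
  next
    assume "cond_F6 a b p f"
    then show ?thesis
      unfolding cond_F6_def less_SUP_iff by (elim bexE) (rule single)
  qed
qed

lemma objective_unbounded_below:
  assumes "cond_F5 a b p f \<or> cond_F6 a b p f"
  shows "\<exists>w. (\<forall>k. 0 \<le> w k) \<and> energy w summable_on UNIV \<and> objective w < - M"
proof -
  obtain c where c: "c > 1 / p_minus p" "\<And>M. \<exists>k. \<exists>t\<ge>M. growth_quotient a b p f k t > c"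
    using growth_quotient_large[OF assms] by blast
  obtain \<beta> where \<beta>: "\<beta> > 0" "\<And>k. \<beta> \<le> b k" using b_bounded_below by blast
  \<comment> \<open>Bounding \<open>b k\<close> below by \<open>\<beta>\<close> makes the decrease
    at least \<open>d * t\<close> wherever the spike sits, which matters because \<open>k\<close> is
    found together with \<open>t\<close>.\<close>
  define d where "d = (c - 1 / p_minus p) * \<beta>"
  have "d > 0" using c(1) \<beta>(1) by (simp add: d_def)
  obtain k t where t: "t \<ge> max 1 (\<bar>M\<bar> / d + 1)" and q: "growth_quotient a b p f k t > c"
    using c(2) by blast
  have "t \<ge> 1" using t by simp
  let ?w = "\<lambda>j. if j = k then t else 0"
  have "M < d * t"
  proof -
    have "\<bar>M\<bar> / d < t" using t by simp
    then show ?thesis using \<open>d > 0\<close> by (simp add: divide_less_eq mult.commute)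
  qed
  also have "\<dots> \<le> (c - 1 / p_minus p) * (b k * t)"
    unfolding d_def mult.assoc using c(1) \<beta>(2)[of k] \<open>t \<ge> 1\<close> by (intro mult_left_mono mult_right_mono) auto
  finally have "objective ?w < - M"
    using spike_objective(2)[OF \<open>t \<ge> 1\<close> q c(1)] by (simp only: mult_minus_left)
  then show ?thesis
    using spike_objective(1)[OF \<open>t \<ge> 1\<close> q c(1)] \<open>t \<ge> 1\<close> by (intro exI[of _ ?w]) auto
qed

text \<open>\<open>level t\<close> is \<open>t powr p_minus p\<close> times the constant in (F4);
  taking \<open>t \<ge> 1\<close> permits clearing the denominator.\<close>

lemma SUP_primitive_less_level:
  assumes "cond_F4 b p f"
  shows "\<exists>t\<ge>M. (\<Sum>\<^sub>\<infinity>k. SUP \<xi>\<in>{-t..t}. primitive f k \<xi>) < level t"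
proof -
  let ?S = "\<lambda>t. \<Sum>\<^sub>\<infinity>k. SUP \<xi>\<in>{-t..t}. primitive f k \<xi>"
  have fr: "\<exists>\<^sub>F t in at_top. ?S t / t powr p_minus p < 1 / (p_plus p * alpha b p powr p_minus p)"
    using frequently_of_Liminf_less[OF assms[unfolded cond_F4_def]] by simp
  obtain t where t: "?S t / t powr p_minus p < 1 / (p_plus p * alpha b p powr p_minus p)" "t \<ge> max 1 M"
    using frequently_ex[OF frequently_eventually_frequently[OF fr eventually_ge_at_top[of "max 1 M"]]] by blast
  then have "?S t < level t"
    by (simp add: divide_less_eq level_def)
  with t(2) show ?thesis by auto
qed

section \<open>Positive solutions of arbitrarily large norm\<close>

lemma positive_solution_of_large_norm:
  assumes F4: "cond_F4 b p f" and F56: "cond_F5 a b p f \<or> cond_F6 a b p f" and "R \<ge> 1"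
  shows "\<exists>u. u \<in> space_E a b p \<and> is_solution a b p f u \<and> (\<forall>k. u k > 0) \<and> norm_E a b p u \<ge> R"
proof -
  let ?S = "\<lambda>t. \<Sum>\<^sub>\<infinity>k. SUP \<xi>\<in>{-t..t}. primitive f k \<xi>"
  have "\<forall>\<^sub>F T in at_top. level T \<ge> R powr p_plus p"
    using level_at_top by (simp add: filterlim_at_top)
  from eventually_happens[OF eventually_conj[OF this eventually_ge_at_top[of "alpha b p"]]]
  obtain T where T: "level T \<ge> R powr p_plus p" "T \<ge> alpha b p" by auto
  have "T > 0" using T(2) alpha_pos by simp
  \<comment> \<open>\<open>T\<close> was chosen so that norm below \<open>R\<close> forces energy at
    most \<open>level T\<close> at each index, hence \<open>\<bar>u k\<bar> \<le> T\<close>; the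
    potential is then at most \<open>?S T\<close>.\<close>
  have small_norm: "- ?S T \<le> objective u"
    if sm: "energy u summable_on UNIV" and "norm_E a b p u < R" for u
  proof -
    have "\<bar>u k\<bar> \<le> T" for k
      using energy_le_of_norm_less[OF that \<open>R \<ge> 1\<close>, of k] T by (intro abs_le_of_energy_le) auto
    from potential_le[OF \<open>T > 0\<close>, of u, OF this] energy_sum_nonneg[of u]
    show ?thesis by (simp add: objective_def)
  qed
  have "?S T \<ge> 0"
    using primitive_le_SUP[of 0 T] \<open>T > 0\<close> by (intro infsum_nonneg) (auto simp: primitive_0)
  \<comment> \<open>A competitor that beats every sequence of summable energy and norm below
    \<open>R\<close>.\<close>
  obtain w where w: "\<And>k. 0 \<le> w k" "energy w summable_on UNIV" "objective w < - ?S T"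
    using objective_unbounded_below[OF F56] by blast
  have "\<forall>\<^sub>F t in at_top. level t \<ge> infsum (energy w) UNIV \<and> t \<ge> alpha b p"
    using level_at_top by (intro eventually_conj eventually_ge_at_top) (simp add: filterlim_at_top)
  then obtain M where M: "\<And>t. t \<ge> M \<Longrightarrow> level t \<ge> infsum (energy w) UNIV \<and> t \<ge> alpha b p"
    by (auto simp: eventually_at_top_linorder)
  \<comment> \<open>\<open>t \<ge> M\<close> puts \<open>w\<close> into the sublevel set, so the
    minimiser also lies below \<open>- ?S T\<close>.\<close>
  obtain t where "t \<ge> M" and St: "?S t < level t"
    using SUP_primitive_less_level[OF F4] by blast
  then have t: "level t \<ge> infsum (energy w) UNIV" "t \<ge> alpha b p" using M by auto
  have "t > 0" using t(2) alpha_pos by simp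
  obtain u where u: "u \<in> sublevel (level t)" and min: "\<And>v. v \<in> sublevel (level t) \<Longrightarrow> objective u \<le> objective v"
    using objective_minimizer[OF t(2)] by blast
  have u_le: "\<bar>u k\<bar> \<le> t" for k by (rule sublevel_abs_le[OF t(2) u])
  have sm: "energy u summable_on UNIV" and u_nonneg: "\<And>k. u k \<ge> 0"
    using u by (auto simp: sublevel_def)
  have "w \<in> sublevel (level t)" using w t by (auto simp: sublevel_def)
  from le_less_trans[OF min[OF this] w(3)] have neg: "objective u < - ?S T" .
  \<comment> \<open>On the boundary the energy would be at least \<open>level t > ?S t\<close>,
    hence exceed the potential, making the objective positive.\<close>
  have interior: "infsum (energy u) UNIV < level t"
  proof (rule ccontr)
    assume "\<not> infsum (energy u) UNIV < level t"
    with potential_le[OF \<open>t > 0\<close>, of u, OF u_le] St have "objective u > 0" by (simp add: objective_def)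
    with neg \<open>?S T \<ge> 0\<close> show False by simp
  qed
  have res: "residual u k \<ge> 0" "u k > 0 \<Longrightarrow> residual u k = 0" for k
    using interior_minimizer_residual[OF u interior _ \<open>t > 0\<close> u_le] min by blast+
  have "\<exists>j. u j \<noteq> 0"
  proof (rule ccontr)
    assume "\<not> (\<exists>j. u j \<noteq> 0)"
    then have "objective u \<ge> 0"
      using energy_sum_nonneg[of u] by (simp add: objective_def potential_def primitive_0)
    with neg \<open>?S T \<ge> 0\<close> show False by simp
  qed
  then have pos: "u k > 0" for k
    using positive_of_residual_nonneg[of u] u_nonneg res(1) by blast
  have "(u \<longlongrightarrow> 0) int_infinity"
  proof (rule tendsto_0_of_energy_le)
    show "energy u k \<le> level t" for k
      using energy_le_infsum[OF sm, of k] interior by simp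
    show "level t > 0"
      using energy_sum_nonneg[of u] interior by simp
  qed
  moreover have "residual u k = 0" for k by (rule res(2)[OF pos])
  ultimately have "is_solution a b p f u"
    by (simp add: is_solution_def residual_def)
  moreover have "norm_E a b p u \<ge> R"
    using small_norm[OF sm] neg by (meson not_le)
  ultimately show ?thesis
    using pos in_space_E[OF sm] by blast
qed

end

theorem theorem4:
  fixes p a b :: "int \<Rightarrow> real" and f :: "int \<Rightarrow> real \<Rightarrow> real"
  assumes p_bdd: "bdd_below (range p)" "bdd_above (range p)"
    and p_gt1: "1 < p_minus p"
    and a_pos: "\<And>k. a k > 0"
    and b_pos: "\<And>k. b k > 0"
    and f_cont: "\<And>k. continuous_on UNIV (f k)"
    and A: "filterlim b at_top int_infinity"
    and F1: "\<And>k. f k 0 = 0"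
    and F2: "\<And>T. T > 0 \<Longrightarrow> (\<lambda>k. SUP t\<in>{-T..T}. \<bar>f k t\<bar>) summable_on UNIV"
    and F4: "cond_F4 b p f"
    and F5_or_F6: "cond_F5 a b p f \<or> cond_F6 a b p f"
  shows "\<exists>u :: nat \<Rightarrow> int \<Rightarrow> real.
    (\<forall>n. u n \<in> space_E a b p \<and> is_solution a b p f (u n) \<and> (\<forall>k. u n k > 0)) \<and>
    filterlim (\<lambda>n. norm_E a b p (u n)) at_top sequentially"
proof -
  interpret discrete_p_problem p a b f
    by unfold_locales (fact p_bdd p_gt1 a_pos b_pos f_cont A F1 F2)+
  \<comment> \<open>\<open>Suc n\<close> rather than \<open>n\<close> meets the requirement
    \<open>R \<ge> 1\<close> also at \<open>n = 0\<close>.\<close>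
  have "\<exists>u. u \<in> space_E a b p \<and> is_solution a b p f u \<and> (\<forall>k. u k > 0) \<and> norm_E a b p u \<ge> real (Suc n)" for n
    by (rule positive_solution_of_large_norm[OF F4 F5_or_F6]) simp
  then obtain u where u: "u n \<in> space_E a b p \<and> is_solution a b p f (u n) \<and> (\<forall>k. u n k > 0)
      \<and> norm_E a b p (u n) \<ge> real (Suc n)" for n
    by metis
  have "filterlim (\<lambda>n. norm_E a b p (u n)) at_top sequentially"
    by (rule filterlim_at_top_mono[OF filterlim_compose[OF filterlim_real_sequentially filterlim_Suc]])
       (use u in auto)
  with u show ?thesis by blast
qed

end
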